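(* For every integer $n\ge 3$ there exists a non-associative AG-group of order $n$.
   Context: An AG-group is a set $G$ with a binary operation (written as juxtaposition) that satisfies the left invertive law $(xy)z=(zy)x$ for all $x,y,z\in G$, has a left identity $e$ (so $ex=x$ for all $x\in G$), and has left inverses (for every $x\in G$ there is $x^{-1}\in G$ with $x^{-1}x=e$). The order of an AG-group is the cardinality of its underlying set. *)

theory Defs
  imports "HOL-Algebra.Coset"
begin

text \<open>
  The record type of monoids serves only as a signature here (carrier, multiplication, and
  \<open>\<one>\<close> for the left identity).
  Inverses are one-sided, so \<open>m_inv\<close>, which requires a two-sided inverse, is not used.
\<close>

locale AG_group =
  fixes G (structure)
  assumes m_closed [intro, simp]:
      "\<lbrakk>x \<in> carrier G; y \<in> carrier G\<rbrakk> \<Longrightarrow> x \<otimes> y \<in> carrier G"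
    and left_invertive:
      "\<lbrakk>x \<in> carrier G; y \<in> carrier G; z \<in> carrier G\<rbrakk>
        \<Longrightarrow> (x \<otimes> y) \<otimes> z = (z \<otimes> y) \<otimes> x"
    and one_closed [intro, simp]: "\<one> \<in> carrier G"
    and l_one [simp]: "x \<in> carrier G \<Longrightarrow> \<one> \<otimes> x = x"
    and l_inv_ex: "x \<in> carrier G \<Longrightarrow> \<exists>y \<in> carrier G. y \<otimes> x = \<one>"

definition associative :: "('a, 'b) monoid_scheme \<Rightarrow> bool" where
  "associative G \<longleftrightarrow>
    (\<forall>x \<in> carrier G. \<forall>y \<in> carrier G. \<forall>z \<in> carrier G.
      (x \<otimes>\<^bsub>G\<^esub> y) \<otimes>\<^bsub>G\<^esub> z = x \<otimes>\<^bsub>G\<^esub> (y \<otimes>\<^bsub>G\<^esub> z))"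

end

theory Submission
  imports Defs
begin

text \<open>
  In an abelian group, reversed subtraction \<open>x \<cdot> y = y - x\<close> is an AG-group operation:
  \<open>(x \<cdot> y) \<cdot> z = z - y + x\<close> is symmetric under exchanging \<open>x\<close> and \<open>z\<close>, the zero is a left
  identity, and every element is its own left inverse.  On the other hand
  \<open>x \<cdot> (y \<cdot> z) = z - y - x\<close>, so the operation is associative only if \<open>2x = 0\<close> for every \<open>x\<close>.
  The cyclic group of order \<open>n \<ge> 3\<close> violates this at \<open>x = 1\<close>, and hence \<open>\<int>/n\<int>\<close> with reversed
  subtraction is the required example.
\<close>

text \<open>
  Residues are represented by naturals below \<open>n\<close>; the subtraction is carried out in the integers
  to avoid truncation.
\<close>

definition reversed_subtraction_mod :: "nat \<Rightarrow> nat monoid" where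
  "reversed_subtraction_mod n =
    \<lparr>carrier = {..<n}, mult = (\<lambda>x y. nat ((int y - int x) mod int n)), one = 0\<rparr>"

lemma carrier_reversed_subtraction_mod:
  "carrier (reversed_subtraction_mod n) = {..<n}"
  by (simp add: reversed_subtraction_mod_def)

lemma one_reversed_subtraction_mod:
  "\<one>\<^bsub>reversed_subtraction_mod n\<^esub> = 0"
  by (simp add: reversed_subtraction_mod_def)

lemma int_mult_reversed_subtraction_mod:
  assumes "n > 0"
  shows "int (x \<otimes>\<^bsub>reversed_subtraction_mod n\<^esub> y) = (int y - int x) mod int n"
  using assms by (simp add: reversed_subtraction_mod_def)

lemma AG_group_reversed_subtraction_mod:
  assumes "n > 0"
  shows "AG_group (reversed_subtraction_mod n)"
proof -
  let ?G = "reversed_subtraction_mod n"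
  note int_mult = int_mult_reversed_subtraction_mod[OF assms]
  have closed: "x \<otimes>\<^bsub>?G\<^esub> y < n" for x y
  proof -
    have "int (x \<otimes>\<^bsub>?G\<^esub> y) < int n"
      unfolding int_mult using assms by simp
    then show ?thesis by simp
  qed
  have left_invertive: "(x \<otimes>\<^bsub>?G\<^esub> y) \<otimes>\<^bsub>?G\<^esub> z = (z \<otimes>\<^bsub>?G\<^esub> y) \<otimes>\<^bsub>?G\<^esub> x" for x y z
  proof -
    have "int ((x \<otimes>\<^bsub>?G\<^esub> y) \<otimes>\<^bsub>?G\<^esub> z) = int ((z \<otimes>\<^bsub>?G\<^esub> y) \<otimes>\<^bsub>?G\<^esub> x)"
      unfolding int_mult mod_diff_right_eq by (simp add: algebra_simps)
    then show ?thesis by simp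
  qed
  have left_one: "0 \<otimes>\<^bsub>?G\<^esub> x = x" if "x < n" for x
  proof -
    have "int (0 \<otimes>\<^bsub>?G\<^esub> x) = int x"
      unfolding int_mult using that by simp
    then show ?thesis by simp
  qed
  have self_inverse: "x \<otimes>\<^bsub>?G\<^esub> x = 0" for x
  proof -
    have "int (x \<otimes>\<^bsub>?G\<^esub> x) = 0"
      unfolding int_mult by simp
    then show ?thesis by simp
  qed
  have left_inverse: "\<exists>y\<in>{..<n}. y \<otimes>\<^bsub>?G\<^esub> x = 0" if "x < n" for x
    using that self_inverse by (intro bexI[of _ x]) simp_all
  show ?thesis
    by (rule AG_group.intro, unfold carrier_reversed_subtraction_mod one_reversed_subtraction_mod)
      (simp_all add: assms closed left_one left_inverse, rule left_invertive)
qed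

text \<open>
  At \<open>(x, y, z) = (1, 0, 0)\<close> the two bracketings are \<open>1\<close> and \<open>-1\<close>, which are distinct residues
  because \<open>n\<close> does not divide \<open>2\<close>.
\<close>

lemma not_associative_reversed_subtraction_mod:
  assumes "n \<ge> 3"
  shows "\<not> associative (reversed_subtraction_mod n)"
proof
  let ?G = "reversed_subtraction_mod n"
  have "n > 0" using assms by simp
  note int_mult = int_mult_reversed_subtraction_mod[OF this]
  assume "associative ?G"
  then have "(1 \<otimes>\<^bsub>?G\<^esub> 0) \<otimes>\<^bsub>?G\<^esub> 0 = 1 \<otimes>\<^bsub>?G\<^esub> (0 \<otimes>\<^bsub>?G\<^esub> 0)"
    using assms by (simp add: associative_def carrier_reversed_subtraction_mod)
  then have "int ((1 \<otimes>\<^bsub>?G\<^esub> 0) \<otimes>\<^bsub>?G\<^esub> 0) = int (1 \<otimes>\<^bsub>?G\<^esub> (0 \<otimes>\<^bsub>?G\<^esub> 0))"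
    by simp
  then have "1 mod int n = (- 1) mod int n"
    unfolding int_mult mod_diff_right_eq by simp
  then have "int n dvd 2"
    by (simp add: mod_eq_dvd_iff)
  then show False
    using assms zdvd_imp_le[of "int n" 2] by simp
qed

theorem corollary3:
  fixes n :: nat
  assumes "n \<ge> 3"
  shows "\<exists>G :: nat monoid. AG_group G \<and> \<not> associative G \<and> order G = n"
proof (intro exI conjI)
  show "AG_group (reversed_subtraction_mod n)"
    using assms by (intro AG_group_reversed_subtraction_mod) simp
  show "\<not> associative (reversed_subtraction_mod n)"
    using assms by (rule not_associative_reversed_subtraction_mod)
  show "order (reversed_subtraction_mod n) = n"
    by (simp add: order_def carrier_reversed_subtraction_mod)
qed

end
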